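(* Let $l \le x_0 < r$ and let $g$ be a continuous, positive and strictly decreasing function on $(x_0,r)$, twice differentiable there, with $g(x)>0$ and $g'(x)<0$ for all $x\in(x_0,r)$. Define $$P(x)=-f(x)\frac{g(x)}{g'(x)},\qquad x\in(x_0,r),$$ and suppose that $\lim_{x\to r}P(x)=0$. (i) The function $\dfrac{f(x)}{-g'(x)}$ is decreasing on $(x_0,r)$ if and only if $P'(x)+f(x)\le 0$ for all $x\in(x_0,r)$; and if this holds, then $$1-F(x)\le P(x)\qquad\text{for all }x\in(x_0,r).$$ (ii) The function $\dfrac{f(x)}{-g'(x)}$ is increasing on $(x_0,r)$ if and only if $P'(x)+f(x)\ge 0$ for all $x\in(x_0,r)$; and if this holds, then $$1-F(x)\ge P(x)\qquad\text{for all }x\in(x_0,r).$$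
   Context: $X$ is a continuous real random variable with cumulative distribution function $F(x)=\Pr\{X\le x\}$ and probability density function $f(x)=F'(x)$. The support of $f$ is an interval with endpoints $l$ and $r$, $-\infty\le l<r\le\infty$, each endpoint being included or not. The density $f$ is continuous on the support and its derivative $f'$ exists there. "Decreasing" and "increasing" without the word "strictly" are meant in the weak sense (derivative $\le 0$, respectively $\ge 0$). The limit as $x\to r$ is taken from the left. *)

theory Defs
  imports "HOL-Probability.Probability"
begin

text \<open>
  The interval may contain either, both or none of its endpoints, which may be infinite.
  For \<open>l < r\<close> these are exactly the real intervals with endpoints \<open>l\<close> and \<open>r\<close>.
\<close>

definition interval_with_endpoints :: "ereal \<Rightarrow> ereal \<Rightarrow> real set \<Rightarrow> bool" where
  "interval_with_endpoints l r S \<longleftrightarrow>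
     einterval l r \<subseteq> S \<and> S \<subseteq> {x. l \<le> ereal x \<and> ereal x \<le> r}"

end

theory Submission
  imports Defs
begin

text \<open>
  Write \<open>h = f / - g'\<close>, so that \<open>P = h * g\<close> on \<open>(x\<^sub>0, r)\<close>. Since \<open>h * g' = - f\<close>, the product rule
  gives \<open>P' + f = h' * g\<close>, and as \<open>g > 0\<close> the sign of \<open>P' + f\<close> is the sign of \<open>h'\<close>. This is the
  equivalence in each part.

  Moreover \<open>P' + f\<close> is the derivative of \<open>P + F\<close>, because \<open>F\<close> is an antiderivative of the
  continuous density (\<open>cdf_has_real_derivative\<close>). So \<open>P + F\<close> is monotone in the same
  direction as \<open>h\<close>. Its limit at \<open>r\<close> is \<open>0 + 1\<close> by \<open>cdf_tendsto_1_at_right_endpoint\<close>, and a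
  monotone function lies on one side of its limit (\<open>mono_on_einterval_le_limit\<close>). This
  compares \<open>P + F\<close> with \<open>1\<close>, which is the tail bound.

  The decreasing case follows from the increasing one by a change of sign.
\<close>

section \<open>Monotone functions on an open interval\<close>

lemma at_left_ereal_nontrivial:
  fixes r :: ereal
  assumes "a < r"
  shows "at_left r \<noteq> bot"
  using assms by (auto simp: trivial_limit_def eventually_at_left[OF assms] dest: dense)

lemma mono_on_einterval_iff_deriv_nonneg:
  fixes h h' :: "real \<Rightarrow> real"
  assumes deriv: "\<And>x. x \<in> einterval a b \<Longrightarrow> (h has_real_derivative h' x) (at x)"
  shows "mono_on (einterval a b) h \<longleftrightarrow> (\<forall>x\<in>einterval a b. h' x \<ge> 0)"
proof
  assume "mono_on (einterval a b) h"
  then show "\<forall>x\<in>einterval a b. h' x \<ge> 0"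
    using mono_on_imp_deriv_nonneg[OF _ deriv] by (simp add: interior_open)
next
  assume nonneg: "\<forall>x\<in>einterval a b. h' x \<ge> 0"
  show "mono_on (einterval a b) h"
  proof (rule mono_onI)
    fix x y assume xy: "x \<in> einterval a b" "y \<in> einterval a b" "x \<le> y"
    have "z \<in> einterval a b" if "x \<le> z" "z \<le> y" for z
      using xy that by (auto simp: einterval_def intro: less_le_trans[of a "ereal x"] le_less_trans[of _ "ereal y"])
    then show "h x \<le> h y"
      using nonneg deriv by (intro DERIV_nonneg_imp_nondecreasing[OF xy(3)]) blast
  qed
qed

lemma antimono_on_iff_mono_on_uminus:
  fixes h :: "real \<Rightarrow> real"
  shows "antimono_on A h \<longleftrightarrow> mono_on A (\<lambda>x. - h x)"
  by (auto simp: monotone_on_def)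

text \<open>
  A value of an increasing function is a lower bound for all later values, hence for their limit.
  Taking the limit in the extended reals treats finite \<open>r\<close> and \<open>r = \<infinity>\<close> at once.
\<close>
lemma mono_on_einterval_le_limit:
  fixes Q :: "real \<Rightarrow> real" and r :: ereal
  assumes mono: "mono_on (einterval a r) Q"
    and lim: "((Q \<circ> real_of_ereal) \<longlongrightarrow> c) (at_left r)"
    and x: "x \<in> einterval a r"
  shows "Q x \<le> c"
proof -
  have xr: "ereal x < r"
    using x by (simp add: einterval_def)
  have "Q x \<le> (Q \<circ> real_of_ereal) y" if y: "ereal x < y" "y < r" for y
  proof -
    obtain z where z: "y = ereal z"
      using y by (cases y) auto
    then have "z \<in> einterval a r" "x \<le> z"
      using y x by (auto simp: einterval_def intro: less_trans)
    then show ?thesis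
      using mono_onD[OF mono x] z by simp
  qed
  then have "\<forall>\<^sub>F y in at_left r. Q x \<le> (Q \<circ> real_of_ereal) y"
    using xr by (auto simp: eventually_at_left[OF xr])
  then show ?thesis
    by (rule tendsto_lowerbound[OF lim _ at_left_ereal_nontrivial[OF xr]])
qed

section \<open>The distribution function of a density supported on an interval\<close>

text \<open>
  Near \<open>x\<close> the distribution function is, up to the constant \<open>F(a)\<close>, the integral of a continuous
  function over \<open>[a, y]\<close>, so the fundamental theorem of calculus applies. Comparing with a
  point \<open>a\<close> inside the interval, instead of integrating from \<open>-\<infinity>\<close>, keeps the integrand
  continuous on a compact interval.
\<close>
lemma cdf_has_real_derivative:
  fixes f :: "real \<Rightarrow> real"
  assumes M: "prob_space M"
    and distr: "distributed M lborel X (\<lambda>x. ennreal (f x))"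
    and nonneg: "\<And>x. f x \<ge> 0"
    and cont: "continuous_on (einterval l r) f"
    and x: "x \<in> einterval l r"
  shows "(cdf (distr M borel X) has_real_derivative f x) (at x)"
proof -
  interpret M: prob_space M by fact
  have rv: "X \<in> borel_measurable M"
    using distributed_measurable[OF distr] by simp
  interpret D: real_distribution "distr M borel X"
    using rv by (rule M.real_distribution_distr)
  obtain d where d: "d > 0" "cball x d \<subseteq> einterval l r"
    using open_einterval x by (metis open_contains_cball)
  define a b where "a = x - d" and "b = x + d"
  have ab: "a < x" "x < b" "{a..b} \<subseteq> einterval l r"
    using d by (auto simp: a_def b_def cball_eq_atLeastAtMost)
  have cont_ab: "continuous_on {a..b} f"
    using cont ab(3) by (rule continuous_on_subset)
  have increment: "cdf (distr M borel X) y = cdf (distr M borel X) a + integral {a..y} f"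
    if "y \<in> {a<..<b}" for y
  proof -
    have "f integrable_on {a..y}"
      using that by (intro integrable_continuous_real continuous_on_subset[OF cont_ab]) auto
    then have "(f has_integral integral {a..y} f) {a..y}"
      by (rule integrable_integral)
    then have "(f has_integral integral {a..y} f) {a<..y}"
      by (subst has_integral_spike_set_eq[where T = "{a..y}"])
        (auto intro: negligible_subset[of "{a}"])
    then have I: "(\<integral>\<^sup>+z. ennreal (f z) * indicator {a<..y} z \<partial>lborel) = ennreal (integral {a..y} f)"
      using nonneg by (intro nn_integral_has_integral_lebesgue') auto
    have "emeasure (distr M borel X) {a<..y} = ennreal (integral {a..y} f)"
      using rv distributed_emeasure[OF distr, of "{a<..y}"] I by (simp add: emeasure_distr)
    moreover have "integral {a..y} f \<ge> 0"
      using nonneg by (intro Henstock_Kurzweil_Integration.integral_nonneg \<open>f integrable_on {a..y}\<close>) auto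
    ultimately have "measure (distr M borel X) {a<..y} = integral {a..y} f"
      by (simp add: measure_def)
    then show ?thesis
      using D.cdf_diff_eq[of a y] that by simp
  qed
  have "((\<lambda>y. integral {a..y} f) has_real_derivative f x) (at x within {a..b})"
    using ab by (intro integral_has_real_derivative cont_ab) auto
  then have "((\<lambda>y. integral {a..y} f) has_real_derivative f x) (at x)"
    using ab by (simp add: at_within_Icc_at)
  then have "((\<lambda>y. cdf (distr M borel X) a + integral {a..y} f) has_real_derivative f x) (at x)"
    by (auto intro!: derivative_eq_intros)
  then show ?thesis
    by (rule has_field_derivative_transform_within_open[where S = "{a<..<b}"])
      (use ab increment in auto)
qed

text \<open>
  If \<open>r\<close> is finite, the left limit of the distribution function at \<open>r\<close> is the probability of
  \<open>(-\<infinity>, r)\<close>. This is \<open>1\<close>, because the density vanishes beyond \<open>r\<close> and the point \<open>r\<close> itself is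
  a null set.
\<close>
lemma cdf_tendsto_1_at_right_endpoint:
  fixes f :: "real \<Rightarrow> real" and r :: ereal
  assumes M: "prob_space M"
    and distr: "distributed M lborel X (\<lambda>x. ennreal (f x))"
    and zero: "\<And>x. r < ereal x \<Longrightarrow> f x = 0"
    and r: "r \<noteq> -\<infinity>"
  shows "((cdf (distr M borel X) \<circ> real_of_ereal) \<longlongrightarrow> 1) (at_left r)"
proof -
  interpret M: prob_space M by fact
  have rv: "X \<in> borel_measurable M"
    using distributed_measurable[OF distr] by simp
  interpret D: real_distribution "distr M borel X"
    using rv by (rule M.real_distribution_distr)
  show ?thesis
  proof (cases r)
    case (real b)
    (* b is excluded almost everywhere because the density need not vanish there *)
    have "AE x in lborel. ennreal (f x) * indicator {b..} x = 0"
      using AE_lborel_singleton[of b]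
    proof (eventually_elim)
      case (elim x)
      then show ?case
        using zero[of x] real by (auto simp: indicator_def)
    qed
    then have "(\<integral>\<^sup>+x. ennreal (f x) * indicator {b..} x \<partial>lborel) = 0"
      using nn_integral_cong_AE by fastforce
    then have "emeasure (distr M borel X) {b..} = 0"
      using rv distributed_emeasure[OF distr, of "{b..}"] by (simp add: emeasure_distr)
    moreover have "{..<b} = space (distr M borel X) - {b..}"
      by auto
    ultimately have "measure (distr M borel X) {..<b} = 1"
      using D.prob_compl[of "{b..}"] by (simp add: measure_def)
    then show ?thesis
      using D.cdf_at_left[of b] real by (simp add: at_left_ereal filterlim_filtermap)
  next
    case PInf
    then show ?thesis
      using D.cdf_lim_at_top_prob
      by (simp add: at_left_PInf filterlim_filtermap)
  qed (use r in simp)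
qed

section \<open>The tail bounds\<close>

theorem theorem1:
  fixes M :: "'a measure" and X :: "'a \<Rightarrow> real"
    and F f g P :: "real \<Rightarrow> real" and l r x0 :: ereal
  assumes "prob_space M"
    and "distributed M lborel X (\<lambda>x. ennreal (f x))"
    and "\<And>x. f x \<ge> 0"
    and "F = cdf (distr M borel X)"
    and "l < r"
    and "interval_with_endpoints l r (support_on UNIV f)"
    and "continuous_on (support_on UNIV f) f"
    and "f differentiable_on support_on UNIV f"
    and "l \<le> x0" and "x0 < r"
    and "continuous_on (einterval x0 r) g"
    and "strict_antimono_on (einterval x0 r) g"
    and "g differentiable_on einterval x0 r"
    and "deriv g differentiable_on einterval x0 r"
    and "\<And>x. x \<in> einterval x0 r \<Longrightarrow> g x > 0"
    and "\<And>x. x \<in> einterval x0 r \<Longrightarrow> deriv g x < 0"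
    and "\<And>x. x \<in> einterval x0 r \<Longrightarrow> P x = - f x * (g x / deriv g x)"
    and "((P \<circ> real_of_ereal) \<longlongrightarrow> 0) (at_left r)"
  shows "(antimono_on (einterval x0 r) (\<lambda>x. f x / - deriv g x)
            \<longleftrightarrow> (\<forall>x\<in>einterval x0 r. deriv P x + f x \<le> 0))
       \<and> (antimono_on (einterval x0 r) (\<lambda>x. f x / - deriv g x)
            \<longrightarrow> (\<forall>x\<in>einterval x0 r. 1 - F x \<le> P x))
       \<and> (mono_on (einterval x0 r) (\<lambda>x. f x / - deriv g x)
            \<longleftrightarrow> (\<forall>x\<in>einterval x0 r. deriv P x + f x \<ge> 0))
       \<and> (mono_on (einterval x0 r) (\<lambda>x. f x / - deriv g x)
            \<longrightarrow> (\<forall>x\<in>einterval x0 r. 1 - F x \<ge> P x))"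
proof -
  let ?I = "einterval x0 r" and ?h = "\<lambda>x. f x / - deriv g x"
  have support: "einterval l r \<subseteq> support_on UNIV f"
    and support_le: "\<And>x. x \<in> support_on UNIV f \<Longrightarrow> ereal x \<le> r"
    using assms(6) by (auto simp: interval_with_endpoints_def)
  have I_subset: "?I \<subseteq> einterval l r"
    using assms(9) by (auto simp: einterval_def intro: le_less_trans)
  have f_deriv: "(f has_real_derivative deriv f x) (at x)" if "x \<in> ?I" for x
    using differentiable_on_subset[OF assms(8) subset_trans[OF I_subset support]] that
    by (simp add: differentiable_on_eq_differentiable_at
        DERIV_deriv_iff_real_differentiable)
  have g_deriv: "(g has_real_derivative deriv g x) (at x)"
    and g'_deriv: "(deriv g has_real_derivative deriv (deriv g) x) (at x)" if "x \<in> ?I" for x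
    using assms(13,14) that
    by (simp_all add: differentiable_on_eq_differentiable_at
        DERIV_deriv_iff_real_differentiable)
  have h_deriv: "(?h has_real_derivative deriv ?h x) (at x)" if "x \<in> ?I" for x
  proof -
    have "?h differentiable at x"
      using f_deriv[OF that] g'_deriv[OF that] assms(16)[OF that]
      by (intro differentiable_divide differentiable_minus)
        (auto simp: real_differentiable_def)
    then show ?thesis
      by (simp add: DERIV_deriv_iff_real_differentiable)
  qed
  have P_deriv: "(P has_real_derivative deriv ?h x * g x - f x) (at x)" if "x \<in> ?I" for x
  proof -
    have "((\<lambda>x. ?h x * g x) has_real_derivative deriv ?h x * g x + deriv g x * ?h x) (at x)"
      by (rule DERIV_mult[OF h_deriv[OF that] g_deriv[OF that]])
    moreover have "deriv g x * ?h x = - f x"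
      using assms(16)[OF that] by simp
    ultimately have "((\<lambda>x. ?h x * g x) has_real_derivative deriv ?h x * g x - f x) (at x)"
      by (simp only: diff_conv_add_uminus)
    then show ?thesis
      by (rule has_field_derivative_transform_within_open[where S = ?I])
        (use that assms(17) in auto)
  qed
  have P'_plus_f: "deriv P x + f x = deriv ?h x * g x" if "x \<in> ?I" for x
    using DERIV_imp_deriv[OF P_deriv[OF that]] by simp
  have F_deriv: "(F has_real_derivative f x) (at x)" if "x \<in> ?I" for x
    unfolding assms(4)
    using cdf_has_real_derivative[OF assms(1-3) continuous_on_subset[OF assms(7) support]]
      I_subset that by blast
  have F_lim: "((F \<circ> real_of_ereal) \<longlongrightarrow> 1) (at_left r)"
    unfolding assms(4)
  proof (rule cdf_tendsto_1_at_right_endpoint[OF assms(1,2)])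
    show "f x = 0" if "r < ereal x" for x
      using support_le[of x] that by (auto simp: support_on_def simp flip: not_le)
    show "r \<noteq> -\<infinity>"
      using assms(10) by auto
  qed

  (* P + F: its derivative is the quantity whose sign is at stake, and its limit at r is 1 *)
  let ?Q = "\<lambda>x. P x + F x"
  have Q_deriv: "(?Q has_real_derivative deriv P x + f x) (at x)" if "x \<in> ?I" for x
    using DERIV_add[OF P_deriv F_deriv] that P'_plus_f by simp
  have Q_lim: "((?Q \<circ> real_of_ereal) \<longlongrightarrow> 1) (at_left r)"
    using tendsto_add[OF assms(18) F_lim] by (simp add: o_def)

  have inc_iff: "mono_on ?I ?h \<longleftrightarrow> (\<forall>x\<in>?I. deriv P x + f x \<ge> 0)"
  proof -
    have "mono_on ?I ?h \<longleftrightarrow> (\<forall>x\<in>?I. deriv ?h x \<ge> 0)"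
      by (rule mono_on_einterval_iff_deriv_nonneg[OF h_deriv])
    also have "\<dots> \<longleftrightarrow> (\<forall>x\<in>?I. deriv P x + f x \<ge> 0)"
      using P'_plus_f assms(15) by (intro ball_cong refl) (simp add: zero_le_mult_iff order.strict_iff_not)
    finally show ?thesis .
  qed
  have dec_iff: "antimono_on ?I ?h \<longleftrightarrow> (\<forall>x\<in>?I. deriv P x + f x \<le> 0)"
  proof -
    have "antimono_on ?I ?h \<longleftrightarrow> (\<forall>x\<in>?I. - deriv ?h x \<ge> 0)"
      unfolding antimono_on_iff_mono_on_uminus
      by (rule mono_on_einterval_iff_deriv_nonneg[OF DERIV_minus[OF h_deriv]])
    also have "\<dots> \<longleftrightarrow> (\<forall>x\<in>?I. deriv P x + f x \<le> 0)"
      using P'_plus_f assms(15) by (intro ball_cong refl) (simp add: mult_le_0_iff order.strict_iff_not)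
    finally show ?thesis .
  qed
  have inc_bound: "1 - F x \<ge> P x" if "\<forall>x\<in>?I. deriv P x + f x \<ge> 0" "x \<in> ?I" for x
  proof -
    have "mono_on ?I ?Q"
      using mono_on_einterval_iff_deriv_nonneg[OF Q_deriv] that(1) by blast
    from mono_on_einterval_le_limit[OF this Q_lim that(2)] show ?thesis
      by simp
  qed
  have dec_bound: "1 - F x \<le> P x" if "\<forall>x\<in>?I. deriv P x + f x \<le> 0" "x \<in> ?I" for x
  proof -
    have "mono_on ?I (\<lambda>x. - ?Q x)"
      using mono_on_einterval_iff_deriv_nonneg[OF DERIV_minus[OF Q_deriv]] that(1) by auto
    moreover have "(((\<lambda>x. - ?Q x) \<circ> real_of_ereal) \<longlongrightarrow> - 1) (at_left r)"
      using tendsto_minus[OF Q_lim] by (simp add: o_def)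
    ultimately have "- ?Q x \<le> - 1"
      using that(2) by (rule mono_on_einterval_le_limit)
    then show ?thesis
      by simp
  qed
  show ?thesis
    using inc_iff dec_iff inc_bound dec_bound by blast
qed

end
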